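(* With the definitions in the context, when computed at $$L_R=L_R':=\frac{\pi\hat s_\theta^2}{\alpha}+K_1,$$ the effective amplitude for any two massless neutral currents (fermions $f_1,f_2$) reproduces, at any real value $p^2\neq0$ at which the exact amplitude is finite, the exact all-order (one-fermion-loop resummed) result of the electroweak theory: $$A_Z^{\rm EFF}(p^2,L_R')=A_Z^{\rm SM}(p^2).$$
   Context: **Data.** Let $\alpha,G_F>0$, $\hat s_\theta^2\in(0,1)$, and let $m_e,m_\mu,m_\tau,m_u,m_d,m_c,m_s,m_t,m_b>0$ be fermion masses (fixed units). Put $$K_1=\tfrac12+\tfrac1{12}\ln(m_e^2m_\mu^2m_\tau^2)+\tfrac16\ln(m_u^2m_c^2m_t^2)+\tfrac1{12}\ln(m_d^2m_s^2m_b^2),$$ $$K_2=\tfrac12+\tfrac18\ln(m_e^2m_\mu^2m_\tau^2)+\tfrac16\ln(m_u^2m_c^2m_t^2)+\tfrac1{24}\ln(m_d^2m_s^2m_b^2),$$ $\hat M^2=\pi\alpha/(\sqrt2\,G_F\hat s_\theta^2)$. $L_R=\ln\mu_R^2$ is a variable ($\mu_R$ the renormalization scale), and $L=\ln(-p^2-i\epsilon)$, i.e. $L=\ln|p^2|$ for $p^2<0$, $L=\ln p^2-i\pi$ for $p^2>0$. **Parameters as functions of $L_R$** (solution of the fit to low-energy data, the same in both theories): $$F_1=1-\frac{\alpha}{\pi\hat s_\theta^2}(L_R-K_1),\quad F_2=1-\frac{8\alpha}{3\pi}(L_R-K_2),\quad s_\theta^2=\hat s_\theta^2\frac{F_1}{F_2},\quad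 c_\theta^2=1-s_\theta^2,$$ $$g^2=\frac{4\pi\alpha}{\hat s_\theta^2F_1},\quad M^2=\frac{\hat M^2}{F_1}\big(1-\sqrt2\,G_F\Sigma_W(0)\big),\quad \Sigma_W(0)=\frac{3m_t^2}{8\pi^2}\Big(L_R-\ln m_t^2+\tfrac12\Big).$$ **One-fermion-loop functions** ($p^2\ne0$), with $\ell_p:=L_R-L+\tfrac53$: $$\Sigma_Z(p^2)=-\frac{p^2}{\pi^2}\Big(1-2s_\theta^2+\tfrac83s_\theta^4\Big)\ell_p+\frac{3m_t^2}{8\pi^2}(L_R-\ln m_t^2),$$ $$\Pi_A(p^2)=-\frac2{3\pi^2}\ell_p,\qquad \Pi_{ZA}(p^2)=\Pi_{AZ}(p^2)=-\frac1{\pi^2}\Big(\tfrac14-\tfrac23s_\theta^2\Big)\ell_p.$$ **Resummed neutral propagators.** In the basis $(A,Z)$ let $S$ be the symmetric self-energy matrix with entries $S_{AA}=g^2s_\theta^2\,p^2\Pi_A(p^2)$, $S_{ZA}=S_{AZ}=g^2\frac{s_\theta}{c_\theta}\,p^2\Pi_{ZA}(p^2)$, $S_{ZZ}=\frac{g^2}{4c_\theta^2}\Sigma_Z(p^2)$. The bare inverse propagators are $$D_{\rm SM}^{-1}=\mathrm{diag}\big(p^2,\;p^2-M^2/c_\theta^2\big),\qquad D_{\rm EFF}^{-1}=\mathrm{diag}\big(p^2,\;-M^2/c_\theta^2\big).$$ The second is that of the Fermi model, with four-fermion neutral interaction $-\frac{g^2}{8M^2}J_{n\alpha}J_n^\alpha$,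 $J_n^\alpha=\sum_f\bar f\gamma^\alpha(v_f+a_f\gamma_5)f$, plus QED; it has no $Z$ propagator. The all-order resummed propagator matrices are $\Delta^{X}=(D_X^{-1}-S)^{-1}$, $X\in\{\rm SM,EFF\}$. **Amplitudes.** For fermions $f$ with charge $Q_f$ and third isospin component $I_{3f}$, $v_f=I_{3f}-2s_\theta^2Q_f$, $a_f=-I_{3f}$, and vertices $V_A^\alpha(f)=g s_\theta Q_f\gamma^\alpha$, $V_Z^\alpha(f)=\frac{g}{2c_\theta}\gamma^\alpha(v_f+a_f\gamma_5)$. The amplitude between massless $f_1$ and $f_2$ with exchanged virtuality $p^2$ is $$A_Z^{X}(p^2,L_R)=i\sum_{a,b\in\{A,Z\}}\Delta^X_{ab}\,V_{a,\alpha}(f_1)\otimes V_b^\alpha(f_2),$$ a linear combination of the independent Dirac structures $\gamma_\alpha\otimes\gamma^\alpha$, $\gamma_\alpha\gamma_5\otimes\gamma^\alpha$, $\gamma_\alpha\otimes\gamma^\alpha\gamma_5$, $\gamma_\alpha\gamma_5\otimes\gamma^\alpha\gamma_5$. Equality of amplitudes means equality of all four coefficients. The parameters are the functions $s_\theta^2=\hat s_\theta^2F_1/F_2$, $c_\theta^2=1-s_\theta^2$, $g^2=4\pi\alpha/(\hat s_\theta^2F_1)$ and $M^2=(\hat M^2/F_1)\big(1-\sqrt2\,G_F\Sigma_W(0)\big)$ of $L_R$, so each coefficient is a rational function of $L_R$ (only $s_\theta^2$, $c_\theta^2$ and even powers of $g$ enter). The value at $L_R=L_R'$, where $F_1=0$,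 is that of this rational function. $A_Z^{\rm SM}$ does not depend on $L_R$ and is written $A_Z^{\rm SM}(p^2)$. *)

theory Defs
  imports "HOL-Analysis.Analysis" "HOL-Computational_Algebra.Polynomial"
begin

record ew_data =
  alpha :: real
  G_F :: real
  s2hat :: real  \<comment> \<open>the squared sine, not the sine itself\<close>
  m_e :: real
  m_mu :: real
  m_tau :: real
  m_u :: real
  m_d :: real
  m_c :: real
  m_s :: real
  m_t :: real
  m_b :: real

definition valid_data :: "ew_data \<Rightarrow> bool" where
  "valid_data E \<longleftrightarrow> alpha E > 0 \<and> G_F E > 0 \<and> 0 < s2hat E \<and> s2hat E < 1 \<and>
     m_e E > 0 \<and> m_mu E > 0 \<and> m_tau E > 0 \<and>
     m_u E > 0 \<and> m_d E > 0 \<and> m_c E > 0 \<and> m_s E > 0 \<and> m_t E > 0 \<and> m_b E > 0"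

definition K1 :: "ew_data \<Rightarrow> real" where
  "K1 E = 1/2 + 1/12 * ln ((m_e E)^2 * (m_mu E)^2 * (m_tau E)^2)
     + 1/6 * ln ((m_u E)^2 * (m_c E)^2 * (m_t E)^2)
     + 1/12 * ln ((m_d E)^2 * (m_s E)^2 * (m_b E)^2)"

definition K2 :: "ew_data \<Rightarrow> real" where
  "K2 E = 1/2 + 1/8 * ln ((m_e E)^2 * (m_mu E)^2 * (m_tau E)^2)
     + 1/6 * ln ((m_u E)^2 * (m_c E)^2 * (m_t E)^2)
     + 1/24 * ln ((m_d E)^2 * (m_s E)^2 * (m_b E)^2)"

definition M2hat :: "ew_data \<Rightarrow> real" where
  "M2hat E = pi * alpha E / (sqrt 2 * G_F E * s2hat E)"

text \<open>The parameters as functions of \<open>LR\<close>, the logarithm of the squared renormalization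
  scale. \<open>s2\<close>, \<open>c2\<close>, \<open>g2\<close>, \<open>M2\<close> are the squared quantities; they may be negative.\<close>

definition F1 :: "ew_data \<Rightarrow> real \<Rightarrow> real" where
  "F1 E LR = 1 - alpha E / (pi * s2hat E) * (LR - K1 E)"

definition F2 :: "ew_data \<Rightarrow> real \<Rightarrow> real" where
  "F2 E LR = 1 - 8 * alpha E / (3 * pi) * (LR - K2 E)"

definition s2 :: "ew_data \<Rightarrow> real \<Rightarrow> real" where
  "s2 E LR = s2hat E * F1 E LR / F2 E LR"

definition c2 :: "ew_data \<Rightarrow> real \<Rightarrow> real" where
  "c2 E LR = 1 - s2 E LR"

definition g2 :: "ew_data \<Rightarrow> real \<Rightarrow> real" where
  "g2 E LR = 4 * pi * alpha E / (s2hat E * F1 E LR)"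

definition Sigma_W0 :: "ew_data \<Rightarrow> real \<Rightarrow> real" where
  "Sigma_W0 E LR = 3 * (m_t E)^2 / (8 * pi^2) * (LR - ln ((m_t E)^2) + 1/2)"

definition M2 :: "ew_data \<Rightarrow> real \<Rightarrow> real" where
  "M2 E LR = M2hat E / F1 E LR * (1 - sqrt 2 * G_F E * Sigma_W0 E LR)"

text \<open>The values of \<open>LR\<close> at which no denominator in the parameters or in the bare inverse
  propagators vanishes.\<close>

definition regular :: "ew_data \<Rightarrow> real \<Rightarrow> bool" where
  "regular E LR \<longleftrightarrow> F1 E LR \<noteq> 0 \<and> F2 E LR \<noteq> 0 \<and> c2 E LR \<noteq> 0"

text \<open>Only even powers of \<open>g\<close>, \<open>s\<close>, \<open>c\<close> enter the amplitudes, so the choice of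
  square root is immaterial.\<close>

definition s_th :: "ew_data \<Rightarrow> real \<Rightarrow> complex" where
  "s_th E LR = csqrt (of_real (s2 E LR))"

definition c_th :: "ew_data \<Rightarrow> real \<Rightarrow> complex" where
  "c_th E LR = csqrt (of_real (c2 E LR))"

definition g_w :: "ew_data \<Rightarrow> real \<Rightarrow> complex" where
  "g_w E LR = csqrt (of_real (g2 E LR))"

text \<open>The boundary value \<open>ln (- p2 - i 0)\<close>, for \<open>p2 \<noteq> 0\<close>.\<close>

definition L_p :: "real \<Rightarrow> complex" where
  "L_p p2 = (if p2 < 0 then of_real (ln \<bar>p2\<bar>) else of_real (ln p2) - \<i> * of_real pi)"

definition ell :: "real \<Rightarrow> real \<Rightarrow> complex" where
  "ell p2 LR = of_real LR - L_p p2 + 5/3"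

definition Sigma_Z :: "ew_data \<Rightarrow> real \<Rightarrow> real \<Rightarrow> complex" where
  "Sigma_Z E p2 LR =
     - of_real (p2 / pi^2 * (1 - 2 * s2 E LR + 8/3 * (s2 E LR)^2)) * ell p2 LR
     + of_real (3 * (m_t E)^2 / (8 * pi^2) * (LR - ln ((m_t E)^2)))"

definition Pi_A :: "real \<Rightarrow> real \<Rightarrow> complex" where
  "Pi_A p2 LR = - of_real (2 / (3 * pi^2)) * ell p2 LR"

definition Pi_ZA :: "ew_data \<Rightarrow> real \<Rightarrow> real \<Rightarrow> complex" where
  "Pi_ZA E p2 LR = - of_real (1 / pi^2 * (1/4 - 2/3 * s2 E LR)) * ell p2 LR"

text \<open>Matrices in the basis \<open>(A, Z)\<close>: index \<open>1\<close> is the photon, index \<open>2\<close> the \<open>Z\<close>.\<close>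

definition self_energy :: "ew_data \<Rightarrow> real \<Rightarrow> real \<Rightarrow> complex^2^2" where
  "self_energy E p2 LR =
    (let SAA = (g_w E LR)^2 * (s_th E LR)^2 * of_real p2 * Pi_A p2 LR;
         SZA = (g_w E LR)^2 * (s_th E LR / c_th E LR) * of_real p2 * Pi_ZA E p2 LR;
         SZZ = (g_w E LR)^2 / (4 * (c_th E LR)^2) * Sigma_Z E p2 LR
     in vector [vector [SAA, SZA], vector [SZA, SZZ]])"

datatype model = SM | EFF

fun bare_inverse :: "model \<Rightarrow> ew_data \<Rightarrow> real \<Rightarrow> real \<Rightarrow> complex^2^2" where
  "bare_inverse SM E p2 LR =
     vector [vector [of_real p2, 0], vector [0, of_real (p2 - M2 E LR / c2 E LR)]]"
| "bare_inverse EFF E p2 LR =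
     vector [vector [of_real p2, 0], vector [0, of_real (- M2 E LR / c2 E LR)]]"

definition full_inverse :: "model \<Rightarrow> ew_data \<Rightarrow> real \<Rightarrow> real \<Rightarrow> complex^2^2" where
  "full_inverse X E p2 LR = bare_inverse X E p2 LR - self_energy E p2 LR"

definition propagator :: "model \<Rightarrow> ew_data \<Rightarrow> real \<Rightarrow> real \<Rightarrow> complex^2^2" where
  "propagator X E p2 LR = matrix_inv (full_inverse X E p2 LR)"

record fermion =
  charge :: real
  isospin3 :: real

text \<open>Dirac structure on one fermion line: \<open>Vec\<close> is \<open>\<gamma>\<^sup>\<alpha>\<close>, \<open>Axi\<close> is
  \<open>\<gamma>\<^sup>\<alpha> \<gamma>\<^sub>5\<close>. An element of \<open>dirac \<Rightarrow> dirac \<Rightarrow> complex\<close> lists the coefficients of the four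
  independent structures; the first argument refers to the line of the first fermion.\<close>

datatype dirac = Vec | Axi

text \<open>\<open>vertex E f LR \<sigma> $ a\<close> is the coefficient of the structure \<open>\<sigma>\<close> in the
  coupling of the fermion \<open>f\<close> to the boson \<open>a\<close>.\<close>

fun vertex :: "ew_data \<Rightarrow> fermion \<Rightarrow> real \<Rightarrow> dirac \<Rightarrow> complex^2" where
  "vertex E f LR Vec =
     vector [g_w E LR * s_th E LR * of_real (charge f),
             g_w E LR / (2 * c_th E LR) * of_real (isospin3 f - 2 * s2 E LR * charge f)]"
| "vertex E f LR Axi =
     vector [0, g_w E LR / (2 * c_th E LR) * of_real (- isospin3 f)]"

definition amplitude ::
  "model \<Rightarrow> ew_data \<Rightarrow> fermion \<Rightarrow> fermion \<Rightarrow> real \<Rightarrow> real \<Rightarrow> dirac \<Rightarrow> dirac \<Rightarrow> complex" where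
  "amplitude X E f1 f2 p2 LR \<sigma> \<tau> =
     \<i> * (\<Sum>a\<in>UNIV. \<Sum>b\<in>UNIV.
            propagator X E p2 LR $ a $ b * vertex E f1 LR \<sigma> $ a * vertex E f2 LR \<tau> $ b)"

text \<open>The function \<open>f\<close> agrees, up to finitely many points, with a rational function
  whose value at \<open>x\<close> is finite and equal to \<open>v\<close>. Such a \<open>v\<close> is unique. This gives
  meaning to the amplitudes where \<open>F1\<close> vanishes, since there \<open>f x\<close> itself only
  reflects the convention for division by zero.\<close>

definition rational_value :: "(real \<Rightarrow> complex) \<Rightarrow> real \<Rightarrow> complex \<Rightarrow> bool" where
  "rational_value f x v \<longleftrightarrow>
     (\<exists>p q :: complex poly.
        finite {y. f y \<noteq> poly p (of_real y) / poly q (of_real y)} \<and>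
        poly q (of_real x) \<noteq> 0 \<and> v = poly p (of_real x) / poly q (of_real x))"

text \<open>Finiteness of the exact amplitude: the resummed propagator exists. As the exact
  amplitude is independent of \<open>LR\<close>, it is enough to ask this at one regular \<open>LR\<close>.\<close>

definition exact_finite :: "ew_data \<Rightarrow> real \<Rightarrow> bool" where
  "exact_finite E p2 \<longleftrightarrow> (\<exists>LR. regular E LR \<and> invertible (full_inverse SM E p2 LR))"

definition LR' :: "ew_data \<Rightarrow> real" where
  "LR' E = pi * s2hat E / alpha E + K1 E"

end

theory Submission
  imports Defs
begin

text \<open>All couplings are combinations of the charge \<open>Q\<close> and of the left-handed isospin current \<open>T\<close>.
  Rewritten in the \<open>(Q, T)\<close> basis, the resummed inverse propagator of the electroweak theory has
  entries that do not depend on \<open>LR\<close>: the running of \<open>1 / g2\<close> and of \<open>1 / (g2 * s2)\<close> cancels the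
  one of the self-energies. The effective theory only lacks \<open>p2\<close> in the \<open>ZZ\<close> entry, which changes the
  \<open>TT\<close> entry by \<open>- 4 * p2 * c2 / g2\<close>. This is proportional to \<open>c2 * F1\<close>, which has the value \<open>0\<close>
  at \<open>LR'\<close>.\<close>

section \<open>Inverses of 2 by 2 matrices\<close>

lemma matrix_inv_unique:
  fixes A B :: "'a::semiring_1^'n^'n"
  assumes "A ** B = mat 1" "B ** A = mat 1"
  shows "matrix_inv A = B"
  unfolding matrix_inv_def
proof (rule some_equality)
  fix C assume "A ** C = mat 1 \<and> C ** A = mat 1"
  then show "C = B"
    using assms by (metis matrix_mul_assoc matrix_mul_lid matrix_mul_rid)
qed (use assms in simp)

lemma matrix_inv_2:
  fixes a b c d :: "'a::field"
  assumes "a * d - b * c \<noteq> 0"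
  shows "matrix_inv (vector [vector [a, b], vector [c, d]] :: 'a^2^2) =
    vector [vector [d / (a * d - b * c), - b / (a * d - b * c)],
            vector [- c / (a * d - b * c), a / (a * d - b * c)]]"
proof (rule matrix_inv_unique)
  have ad: "a * d \<noteq> b * c" using assms by simp
  show "(vector [vector [a, b], vector [c, d]] :: 'a^2^2) **
      vector [vector [d / (a * d - b * c), - b / (a * d - b * c)],
            vector [- c / (a * d - b * c), a / (a * d - b * c)]] = (mat 1 :: 'a^2^2)"
    using ad by (simp add: vec_eq_iff forall_2 matrix_matrix_mult_def sum_2 mat_def divide_simps)
  show "(vector [vector [d / (a * d - b * c), - b / (a * d - b * c)],
            vector [- c / (a * d - b * c), a / (a * d - b * c)]] :: 'a^2^2) **
        vector [vector [a, b], vector [c, d]] = (mat 1 :: 'a^2^2)"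
    using ad by (simp add: vec_eq_iff forall_2 matrix_matrix_mult_def sum_2 mat_def divide_simps)
qed

section \<open>Entries of the inverse propagator in the \<open>(Q, T)\<close> basis\<close>

definition W_QQ :: "ew_data \<Rightarrow> real \<Rightarrow> complex" where
  "W_QQ E p2 = of_real p2 / of_real (4 * pi * alpha E)
     * (1 + of_real (8 * alpha E / (3 * pi)) * (of_real (K2 E) - L_p p2 + 5/3))"

text \<open>Each \<open>W\<close> entry is independent of the scale, hence written at a convenient
  one: \<open>W_QQ\<close> at \<open>K2\<close>, where \<open>F2\<close> is 1, and
  \<open>W_QT\<close> and \<open>W_TT\<close> at \<open>LR'\<close>, where the tree-level terms in
  \<open>1 / g2\<close> drop out.\<close>

definition W_QT :: "ew_data \<Rightarrow> real \<Rightarrow> complex" where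
  "W_QT E p2 = of_real (p2 / (2 * pi^2)) * ell p2 (LR' E)"

definition W_TT :: "ew_data \<Rightarrow> real \<Rightarrow> complex" where
  "W_TT E p2 = of_real (p2 / pi^2) * ell p2 (LR' E)
     - of_real (1 / (sqrt 2 * G_F E) - 3 * (m_t E)^2 / (16 * pi^2))"

definition TT_defect :: "model \<Rightarrow> ew_data \<Rightarrow> real \<Rightarrow> real \<Rightarrow> complex" where
  "TT_defect X E p2 LR = (case X of SM \<Rightarrow> 0 | EFF \<Rightarrow> of_real (4 * p2 * c2 E LR / g2 E LR))"

lemma F1_conv_LR':
  assumes "valid_data E"
  shows "F1 E LR = alpha E / (pi * s2hat E) * (LR' E - LR)"
  using assms by (simp add: valid_data_def F1_def LR'_def field_simps)

lemma regular_nonzero: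
  assumes "valid_data E" "regular E LR"
  shows "g2 E LR \<noteq> 0" "s2 E LR \<noteq> 0" "c2 E LR \<noteq> 0"
  using assms by (auto simp: valid_data_def regular_def g2_def s2_def)

lemma W_QQ_conv:
  assumes "valid_data E" "regular E LR"
  shows "W_QQ E p2 = of_real (p2 / (g2 E LR * s2 E LR)) + of_real (2 * p2 / (3 * pi^2)) * ell p2 LR"
proof -
  have nz: "alpha E \<noteq> 0" "s2hat E \<noteq> 0" "F1 E LR \<noteq> 0" "F2 E LR \<noteq> 0"
    using assms by (auto simp: valid_data_def regular_def)
  have gs: "p2 / (g2 E LR * s2 E LR) = p2 * F2 E LR / (4 * pi * alpha E)"
    using nz by (simp add: g2_def s2_def)
  show ?thesis
    unfolding gs using nz
    by (simp add: W_QQ_def F2_def ell_def field_simps power2_eq_square)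
qed

text \<open>\<open>F1\<close> is affine with zero \<open>LR'\<close>, and its slope makes
  \<open>4 * pi^2 / g2\<close> exactly \<open>LR' - LR\<close>. The tree term in
  \<open>1 / g2\<close> and the loop logarithm thus merge into one logarithm at
  \<open>LR'\<close>.\<close>

lemma ell_LR'_conv:
  assumes "valid_data E" "regular E LR"
  shows "ell p2 (LR' E) = of_real (4 * pi^2 / g2 E LR) + ell p2 LR"
proof -
  have nz: "alpha E \<noteq> 0" "s2hat E \<noteq> 0" "F1 E LR \<noteq> 0"
    using assms by (auto simp: valid_data_def regular_def)
  have "4 * pi^2 / g2 E LR = pi * s2hat E * F1 E LR / alpha E"
    using nz by (simp add: g2_def power2_eq_square)
  also have "\<dots> = LR' E - LR"
    using nz by (simp add: F1_conv_LR'[OF assms(1)])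
  finally show ?thesis by (simp add: ell_def)
qed

text \<open>\<open>F1\<close> cancels in the quotient, so the only running left is that of
  \<open>Sigma_W0\<close>. The top-mass term of \<open>Sigma_Z\<close> compensates it up to the
  constant \<open>3 * m_t^2 / (16 * pi^2)\<close>, which appears in \<open>W_TT\<close>.\<close>

lemma M2_over_g2:
  assumes "valid_data E" "regular E LR"
  shows "4 * M2 E LR / g2 E LR = 1 / (sqrt 2 * G_F E) - Sigma_W0 E LR"
proof -
  have nz: "alpha E \<noteq> 0" "s2hat E \<noteq> 0" "F1 E LR \<noteq> 0" "G_F E \<noteq> 0"
    using assms by (auto simp: valid_data_def regular_def)
  show ?thesis
    using nz by (simp add: M2_def M2hat_def g2_def field_simps)
qed

lemma W_TT_conv:
  assumes "valid_data E" "regular E LR"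
  shows "W_TT E p2 = of_real (4 * (p2 - M2 E LR) / g2 E LR) + of_real (p2 / pi^2) * ell p2 LR
     - of_real (3 * (m_t E)^2 / (8 * pi^2) * (LR - ln ((m_t E)^2)))"
proof -
  have "1 / (sqrt 2 * G_F E) - 3 * (m_t E)^2 / (16 * pi^2)
      = 4 * M2 E LR / g2 E LR + 3 * (m_t E)^2 / (8 * pi^2) * (LR - ln ((m_t E)^2))"
    unfolding M2_over_g2[OF assms] by (simp only: Sigma_W0_def distrib_left) simp
  then show ?thesis
    unfolding W_TT_def ell_LR'_conv[OF assms]
    by (simp add: distrib_left right_diff_distrib diff_divide_distrib)
qed

text \<open>This is the congruence \<open>N W N^T\<close>, where \<open>N\<close> has the rows
  \<open>(G S, 0)\<close> and \<open>(- G S^2 / C, G / (2 C))\<close> and expresses the couplings to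
  \<open>A\<close> and \<open>Z\<close> through \<open>Q\<close> and \<open>T\<close>.\<close>

lemma full_inverse_conv:
  fixes X p2
  assumes "valid_data E" "regular E LR"
  defines "G \<equiv> g_w E LR" and "S \<equiv> s_th E LR" and "C \<equiv> c_th E LR"
  shows "full_inverse X E p2 LR =
    vector [vector [G^2 * S^2 * W_QQ E p2, G^2 * S / C * (W_QT E p2 / 2 - S^2 * W_QQ E p2)],
            vector [G^2 * S / C * (W_QT E p2 / 2 - S^2 * W_QQ E p2),
              G^2 / C^2 * (S^4 * W_QQ E p2 - S^2 * W_QT E p2 + (W_TT E p2 - TT_defect X E p2 LR) / 4)]]"
proof -
  define g s c where "g = complex_of_real (g2 E LR)" and "s = complex_of_real (s2 E LR)"
    and "c = complex_of_real (c2 E LR)"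
  have nz: "g \<noteq> 0" "s \<noteq> 0" "c \<noteq> 0"
    using regular_nonzero[OF assms(1,2)] by (auto simp: g_def s_def c_def)
  have sq: "G^2 = g" "S^2 = s" "C^2 = c"
    by (auto simp: G_def S_def C_def g_w_def s_th_def c_th_def g_def s_def c_def)
  have S4: "S^4 = s^2"
    by (simp flip: sq)
  have c: "c = 1 - s" by (simp add: c_def s_def c2_def)
  have C: "C \<noteq> 0" using sq nz by auto
  define l where "l = ell p2 LR"
  define P where "P = complex_of_real pi"
  have P: "P \<noteq> 0" by (simp add: P_def)
  define p where "p = complex_of_real p2"
  have QQ: "W_QQ E p2 = p / (g * s) + 2 * p / (3 * P^2) * l"
    by (simp add: W_QQ_conv[OF assms(1,2)] g_def s_def p_def l_def P_def)
  have QT: "W_QT E p2 = p / (2 * P^2) * (4 * P^2 / g + l)"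
    by (simp add: W_QT_def ell_LR'_conv[OF assms(1,2)] g_def p_def l_def P_def)
  define m where "m = complex_of_real (M2 E LR)"
  define t where "t = complex_of_real (3 * (m_t E)^2 / (8 * pi^2) * (LR - ln ((m_t E)^2)))"
  have TT: "W_TT E p2 = 4 * (p - m) / g + p / P^2 * l - t"
    unfolding W_TT_conv[OF assms(1,2)] t_def by (simp add: g_def p_def l_def P_def m_def)
  have PA: "Pi_A p2 LR = - 2 / (3 * P^2) * l"
    by (simp add: Pi_A_def P_def l_def)
  have PZA: "Pi_ZA E p2 LR = - (1 / P^2 * (1/4 - 2/3 * s)) * l"
    by (simp add: Pi_ZA_def P_def l_def s_def)
  have SZ: "Sigma_Z E p2 LR = - (p / P^2 * (1 - 2 * s + 8/3 * s^2)) * l + t"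
    unfolding Sigma_Z_def t_def by (simp add: P_def l_def s_def p_def)
  have e11: "p - g * s * p * Pi_A p2 LR = g * s * W_QQ E p2"
    unfolding PA QQ using nz P by (simp add: field_simps)
  have e12: "- (g * (S / C) * p * Pi_ZA E p2 LR) = g * S / C * (W_QT E p2 / 2 - s * W_QQ E p2)"
    unfolding PZA QT QQ using nz P C by (simp add: field_simps)
  have e22: "p - m / c - g / (4 * c) * Sigma_Z E p2 LR
      = g / c * (s^2 * W_QQ E p2 - s * W_QT E p2 + W_TT E p2 / 4)"
  proof -
    \<comment> \<open>Clearing \<open>c\<close> allows the substitution \<open>c = 1 - s\<close>:
      the tree-level terms on the right combine to \<open>p * (1 - 2 * s + s) - m\<close>, and the
      loop terms to the quadratic polynomial in \<open>s\<close> of \<open>Sigma_Z\<close>.\<close>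
    have "c * (p - m / c - g / (4 * c) * Sigma_Z E p2 LR)
        = c * p - m - g / 4 * Sigma_Z E p2 LR"
      using nz by (simp add: field_simps)
    also have "\<dots> = g * (s^2 * W_QQ E p2 - s * W_QT E p2 + W_TT E p2 / 4)"
      unfolding c SZ QQ QT TT using nz P by (simp add: field_simps power2_eq_square)
    finally show ?thesis using nz by (simp add: field_simps)
  qed
  have d: "TT_defect X E p2 LR = (case X of SM \<Rightarrow> 0 | EFF \<Rightarrow> 4 * p * c / g)"
    by (cases X) (simp_all add: TT_defect_def p_def c_def g_def)
  have e22': "(case X of SM \<Rightarrow> p | EFF \<Rightarrow> 0) - m / c - g / (4 * c) * Sigma_Z E p2 LR
      = g / c * (s^2 * W_QQ E p2 - s * W_QT E p2 + (W_TT E p2 - TT_defect X E p2 LR) / 4)"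
  proof (cases X)
    case SM
    then show ?thesis using e22 d by simp
  next
    case EFF
    have "- m / c - g / (4 * c) * Sigma_Z E p2 LR
      = g / c * (s^2 * W_QQ E p2 - s * W_QT E p2 + W_TT E p2 / 4) - p"
      using e22 by (simp add: algebra_simps)
    also have "\<dots> = g / c * (s^2 * W_QQ E p2 - s * W_QT E p2 + (W_TT E p2 - 4 * p * c / g) / 4)"
      using nz by (simp add: field_simps)
    finally show ?thesis using EFF d by simp
  qed
  have bare: "bare_inverse X E p2 LR =
      vector [vector [p, 0], vector [0, (case X of SM \<Rightarrow> p | EFF \<Rightarrow> 0) - m / c]]"
    by (cases X) (simp_all add: p_def m_def c_def)
  show ?thesis
    unfolding full_inverse_def bare self_energy_def Let_def vec_eq_iff forall_2 
      G_def[symmetric] S_def[symmetric] C_def[symmetric] p_def[symmetric] sq S4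
    using e11 e12 e22' by (simp add: diff_diff_eq)
qed

section \<open>Determinant and amplitudes in the \<open>(Q, T)\<close> basis\<close>

definition W_det :: "model \<Rightarrow> ew_data \<Rightarrow> real \<Rightarrow> real \<Rightarrow> complex" where
  "W_det X E p2 LR = W_QQ E p2 * (W_TT E p2 - TT_defect X E p2 LR) - (W_QT E p2)^2"

fun Q_coupling :: "fermion \<Rightarrow> dirac \<Rightarrow> complex" where
  "Q_coupling f Vec = of_real (charge f)"
| "Q_coupling f Axi = 0"

text \<open>The opposite signs encode the left-handed structure \<open>1 - gamma_5\<close>. The
  axial coupling of the \<open>Z\<close> then comes from \<open>T\<close> alone, and one formula
  serves both Dirac structures in \<open>vertex_conv\<close>.\<close>

fun T_coupling :: "fermion \<Rightarrow> dirac \<Rightarrow> complex" where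
  "T_coupling f Vec = of_real (isospin3 f)"
| "T_coupling f Axi = - of_real (isospin3 f)"

text \<open>Multiplicativity of the determinant for \<open>N W N^T\<close>, with
  \<open>det N = G^2 S / (2 C)\<close>.\<close>

lemma det_change_of_basis:
  fixes G S C :: complex
  assumes "C \<noteq> 0"
  shows "G^2 * S^2 * x * (G^2 / C^2 * (S^4 * x - S^2 * y + z / 4))
      - G^2 * S / C * (y / 2 - S^2 * x) * (G^2 * S / C * (y / 2 - S^2 * x))
    = (G^2 * S / (2 * C))^2 * (x * z - y^2)"
  using assms by (simp add: field_simps power2_eq_square power4_eq_xxxx)

lemma roots_nonzero:
  assumes "valid_data E" "regular E LR"
  shows "g_w E LR \<noteq> 0" "s_th E LR \<noteq> 0" "c_th E LR \<noteq> 0"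
  using regular_nonzero[OF assms] by (auto simp: g_w_def s_th_def c_th_def)

lemma invertible_full_inverse_iff:
  assumes "valid_data E" "regular E LR"
  shows "invertible (full_inverse X E p2 LR) \<longleftrightarrow> W_det X E p2 LR \<noteq> 0"
  unfolding invertible_det_nz full_inverse_conv[OF assms] W_det_def
    det_2 vector_2 det_change_of_basis[OF roots_nonzero(3)[OF assms]]
  using roots_nonzero[OF assms] by simp

lemma vertex_conv:
  "vertex E f LR \<sigma> = vector [g_w E LR * s_th E LR * Q_coupling f \<sigma>,
     g_w E LR / (2 * c_th E LR) * (T_coupling f \<sigma> - 2 * (s_th E LR)^2 * Q_coupling f \<sigma>)]"
  by (cases \<sigma>) (simp_all add: s_th_def)

text \<open>The vertices are \<open>N\<close> applied to the \<open>(Q, T)\<close> couplings, so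
  \<open>N\<close> cancels against the inverse of \<open>N W N^T\<close> and only the inverse of
  \<open>W\<close> remains: its adjugate over its determinant. After this \<open>LR\<close> enters
  only through \<open>TT_defect\<close>.\<close>

lemma amplitude_conv:
  assumes "valid_data E" "regular E LR" "W_det X E p2 LR \<noteq> 0"
  shows "amplitude X E f1 f2 p2 LR \<sigma> \<tau> =
    \<i> * ((W_TT E p2 - TT_defect X E p2 LR) * (Q_coupling f1 \<sigma> * Q_coupling f2 \<tau>)
       - W_QT E p2 * (Q_coupling f1 \<sigma> * T_coupling f2 \<tau> + T_coupling f1 \<sigma> * Q_coupling f2 \<tau>)
       + W_QQ E p2 * (T_coupling f1 \<sigma> * T_coupling f2 \<tau>)) / W_det X E p2 LR"
proof -
  define G S C where "G = g_w E LR" and "S = s_th E LR" and "C = c_th E LR"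
  have nz: "G \<noteq> 0" "S \<noteq> 0" "C \<noteq> 0"
    using roots_nonzero[OF assms(1,2)] by (simp_all add: G_def S_def C_def)
  define x y z where "x = W_QQ E p2" and "y = W_QT E p2"
    and "z = W_TT E p2 - TT_defect X E p2 LR"
  define D where "D = x * z - y^2"
  have D: "W_det X E p2 LR = D" "D \<noteq> 0"
    using assms(3) by (simp_all add: W_det_def D_def x_def y_def z_def)
  \<comment> \<open>The square of \<open>det N\<close>, a common factor of the determinant and of
    the contracted adjugate.\<close>
  define k where "k = (G^2 * S / (2 * C))^2"
  have k: "k \<noteq> 0" using nz by (simp add: k_def)
  define a b d where "a = G^2 * S^2 * x" and "b = G^2 * S / C * (y / 2 - S^2 * x)"
    and "d = G^2 / C^2 * (S^4 * x - S^2 * y + z / 4)"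
  have det: "a * d - b * b = k * D"
    unfolding a_def b_def d_def k_def D_def using nz det_change_of_basis by blast
  have full: "full_inverse X E p2 LR = vector [vector [a, b], vector [b, d]]"
    unfolding full_inverse_conv[OF assms(1,2)] a_def b_def d_def x_def y_def z_def G_def S_def C_def ..
  have inv: "propagator X E p2 LR = vector [vector [d / (k * D), - b / (k * D)],
            vector [- b / (k * D), a / (k * D)]]"
    using matrix_inv_2[of a d b b] det k D(2)
    by (simp add: propagator_def full)
  define q q' t t' where "q = Q_coupling f1 \<sigma>" and "q' = Q_coupling f2 \<tau>"
    and "t = T_coupling f1 \<sigma>" and "t' = T_coupling f2 \<tau>"
  define v v' w w' where "v = G * S * q" and "v' = G * S * q'"
    and "w = G / (2 * C) * (t - 2 * S^2 * q)" and "w' = G / (2 * C) * (t' - 2 * S^2 * q')"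
  have "amplitude X E f1 f2 p2 LR \<sigma> \<tau>
      = \<i> * (d / (k * D) * v * v' - b / (k * D) * v * w' - b / (k * D) * w * v' + a / (k * D) * w * w')"
    unfolding amplitude_def inv vertex_conv G_def[symmetric] S_def[symmetric] C_def[symmetric]
      q_def[symmetric] q'_def[symmetric] t_def[symmetric] t'_def[symmetric]
      v_def[symmetric] v'_def[symmetric] w_def[symmetric] w'_def[symmetric]
    by (simp add: sum_2)
  also have "\<dots> = \<i> * (d * v * v' - b * v * w' - b * w * v' + a * w * w') / (k * D)"
    using k D(2) by (simp add: field_simps)
  also have "d * v * v' - b * v * w' - b * w * v' + a * w * w'
     = k * (z * (q * q') - y * (q * t' + t * q') + x * (t * t'))"
    unfolding v_def v'_def w_def w'_def a_def b_def d_def k_def using nz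
    by (simp add: field_simps power2_eq_square power4_eq_xxxx)
  finally show ?thesis
    using k D by (simp add: q_def q'_def t_def t'_def x_def y_def z_def)
qed

section \<open>Rational dependence on \<open>LR\<close>\<close>

lemma finite_not_regular:
  assumes "valid_data E"
  shows "finite {LR. \<not> regular E LR}"
proof -
  have pos: "alpha E > 0" "s2hat E > 0" using assms by (auto simp: valid_data_def)
  have affine: "finite {x. h x = 0}" if "\<And>x. h x = a + b * x" "b \<noteq> 0" for h :: "real \<Rightarrow> real" and a b
    by (rule finite_subset[of _ "{- a / b}"]) (use that in \<open>auto simp: field_simps\<close>)
  have "finite {LR. F1 E LR = 0}"
    by (rule affine[of _ "1 + alpha E / (pi * s2hat E) * K1 E" "- (alpha E / (pi * s2hat E))"])
      (use pos in \<open>simp_all add: F1_def right_diff_distrib\<close>)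
  moreover have "finite {LR. F2 E LR = 0}"
    by (rule affine[of _ "1 + 8 * alpha E / (3 * pi) * K2 E" "- (8 * alpha E / (3 * pi))"])
      (use pos in \<open>simp_all add: F2_def right_diff_distrib\<close>)
  \<comment> \<open>Where \<open>F2\<close> is nonzero, \<open>c2 = 0\<close> amounts to this affine
    equation. It is not degenerate, since \<open>F2\<close> and \<open>s2hat * F1\<close> have the
    distinct slopes \<open>- 8 * alpha / (3 * pi)\<close> and \<open>- alpha / pi\<close>.\<close>
  moreover have "finite {LR. F2 E LR - s2hat E * F1 E LR = 0}"
    by (rule affine[of _ "1 - s2hat E + 8 * alpha E / (3 * pi) * K2 E - alpha E / pi * K1 E"
          "- (5 * alpha E / (3 * pi))"])
      (use pos in \<open>simp_all add: F1_def F2_def field_simps\<close>)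
  ultimately have "finite ({LR. F1 E LR = 0} \<union> {LR. F2 E LR = 0} \<union> {LR. F2 E LR - s2hat E * F1 E LR = 0})"
    by blast
  then show ?thesis
    by (rule rev_finite_subset) (auto simp: regular_def c2_def s2_def field_simps)
qed

text \<open>The defect is a multiple of \<open>c2 * F1\<close>. The task is to write it with a
  denominator that survives at \<open>LR'\<close>, so that the zero of \<open>F1\<close> there makes
  the rational function vanish.\<close>

lemma TT_defect_rational:
  assumes "valid_data E"
  obtains P R :: "complex poly" where
    "\<And>LR. regular E LR \<Longrightarrow> poly R (of_real LR) \<noteq> 0"
    "\<And>LR. regular E LR \<Longrightarrow> TT_defect EFF E p2 LR = poly P (of_real LR) / poly R (of_real LR)"
    "poly R (of_real (LR' E)) \<noteq> 0" "poly P (of_real (LR' E)) = 0"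
proof -
  have pos: "alpha E > 0" "s2hat E > 0" using assms by (auto simp: valid_data_def)
  define r1 where "r1 = alpha E / (pi * s2hat E)"
  define r2 where "r2 = 8 * alpha E / (3 * pi)"
  define k where "k = p2 * s2hat E / (pi * alpha E)"
  define f1 where "f1 = [:complex_of_real (r1 * LR' E), - of_real r1:]"
  define f2 where "f2 = [:complex_of_real (1 + r2 * K2 E), - of_real r2:]"
  have F1: "poly f1 (of_real LR) = of_real (F1 E LR)" for LR
    by (simp add: f1_def F1_conv_LR'[OF assms] flip: r1_def) (simp add: algebra_simps)
  have F2: "poly f2 (of_real LR) = of_real (F2 E LR)" for LR
    by (simp add: f2_def F2_def flip: r2_def) (simp add: algebra_simps)
  have F1': "F1 E (LR' E) = 0" by (simp add: F1_conv_LR'[OF assms])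
  \<comment> \<open>At a zero of \<open>F1\<close> both sides are 0, as division by zero yields
    0.\<close>
  have defect: "TT_defect EFF E p2 LR = of_real (k * (c2 E LR * F1 E LR))" for LR
    by (simp add: TT_defect_def g2_def k_def)
  show thesis
  \<comment> \<open>The denominator \<open>F2\<close> of \<open>s2\<close> is admissible as
    \<open>R\<close> only if it does not vanish at \<open>LR'\<close>; otherwise the common linear
    factor has to be cancelled first.\<close>
  proof (cases "F2 E (LR' E) = 0")
    case False
    show thesis
    proof (rule that[of f2 "smult (of_real k) (f1 * (f2 - smult (of_real (s2hat E)) f1))"])
      fix LR assume "regular E LR"
      then have nz: "F2 E LR \<noteq> 0" by (simp add: regular_def)
      then show "poly f2 (of_real LR) \<noteq> 0" by (simp add: F2)
      show "TT_defect EFF E p2 LR = poly (smult (of_real k) (f1 * (f2 - smult (of_real (s2hat E)) f1)))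
          (of_real LR) / poly f2 (of_real LR)"
        using nz by (simp add: defect F1 F2 c2_def s2_def field_simps)
    qed (use False F1' in \<open>simp_all add: F1 F2\<close>)
  next
    case True
    txt \<open>\<open>F1\<close> and \<open>F2\<close> share their zero, so \<open>s2\<close> is the constant \<open>3/8\<close>.\<close>
    have F2_eq: "F2 E LR = r2 * (LR' E - LR)" for LR
      using True unfolding F2_def r2_def[symmetric] by (simp add: algebra_simps)
    have c2: "c2 E LR = 5/8" if "regular E LR" for LR
      using that pos by (simp add: regular_def c2_def s2_def F2_eq F1_conv_LR'[OF assms] r2_def divide_simps)
    show thesis
      by (rule that[of 1 "smult (of_real (k * (5/8))) f1"]) (simp_all add: F1 F1' defect c2)
  qed
qed

section \<open>Comparison of the two amplitudes at \<open>LR'\<close>\<close>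

theorem theorem2:
  fixes E :: ew_data and f1 f2 :: fermion and p2 :: real
  assumes "valid_data E"
    and "p2 \<noteq> 0"
    and "exact_finite E p2"
  shows "\<exists>A_SM :: dirac \<Rightarrow> dirac \<Rightarrow> complex.
           (\<forall>LR. regular E LR \<longrightarrow> amplitude SM E f1 f2 p2 LR = A_SM) \<and>
           (\<forall>\<sigma> \<tau>. rational_value (\<lambda>LR. amplitude EFF E f1 f2 p2 LR \<sigma> \<tau>) (LR' E) (A_SM \<sigma> \<tau>))"
proof -
  define x y z where "x = W_QQ E p2" and "y = W_QT E p2" and "z = W_TT E p2"
  define D where "D = x * z - y^2"
  have det_SM: "W_det SM E p2 LR = D" for LR
    by (simp add: W_det_def TT_defect_def D_def x_def y_def z_def)
  \<comment> \<open>\<open>D\<close> is free of \<open>LR\<close>, so invertibility at the one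
    regular scale given by \<open>exact_finite\<close> decides it.\<close>
  have D: "D \<noteq> 0"
    using assms by (auto simp: exact_finite_def invertible_full_inverse_iff det_SM)
  define q q' t t' where "q = Q_coupling f1" and "q' = Q_coupling f2"
    and "t = T_coupling f1" and "t' = T_coupling f2"
  define A where "A \<sigma> \<tau> = \<i> * (z * (q \<sigma> * q' \<tau>) - y * (q \<sigma> * t' \<tau> + t \<sigma> * q' \<tau>)
      + x * (t \<sigma> * t' \<tau>)) / D" for \<sigma> \<tau>
  have "amplitude SM E f1 f2 p2 LR = A" if "regular E LR" for LR
    using D amplitude_conv[OF assms(1) that, of SM p2 f1 f2]
    by (intro ext) (simp add: A_def det_SM TT_defect_def x_def y_def z_def q_def q'_def t_def t'_def)
  moreover have "rational_value (\<lambda>LR. amplitude EFF E f1 f2 p2 LR \<sigma> \<tau>) (LR' E) (A \<sigma> \<tau>)" for \<sigma> \<tau>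
  proof -
    obtain P R where PR: "\<And>LR. regular E LR \<Longrightarrow> poly R (of_real LR) \<noteq> 0"
      "\<And>LR. regular E LR \<Longrightarrow> TT_defect EFF E p2 LR = poly P (of_real LR) / poly R (of_real LR)"
      "poly R (of_real (LR' E)) \<noteq> 0" "poly P (of_real (LR' E)) = 0"
      by (rule TT_defect_rational[OF assms(1)]) (rule that)
    \<comment> \<open>Numerator and denominator of the effective amplitude after inserting
      \<open>P / R\<close> for the defect and multiplying through by \<open>R\<close>. At
      \<open>LR'\<close>, where \<open>P\<close> vanishes, they reduce to those of the exact
      amplitude times \<open>R\<close>.\<close>
    define den where "den = smult D R - smult x P"
    define num where "num = smult (\<i> * (z * (q \<sigma> * q' \<tau>) - y * (q \<sigma> * t' \<tau> + t \<sigma> * q' \<tau>)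
      + x * (t \<sigma> * t' \<tau>))) R - smult (\<i> * (q \<sigma> * q' \<tau>)) P"
    have den_LR': "poly den (of_real (LR' E)) \<noteq> 0"
      using PR D by (simp add: den_def)
    have val: "A \<sigma> \<tau> = poly num (of_real (LR' E)) / poly den (of_real (LR' E))"
      using PR(3,4) by (simp add: num_def den_def A_def)
    have ampl: "amplitude EFF E f1 f2 p2 LR \<sigma> \<tau> = poly num (of_real LR) / poly den (of_real LR)"
      if reg: "regular E LR" and den: "poly den (of_real LR) \<noteq> 0" for LR
    proof -
      have det: "W_det EFF E p2 LR = poly den (of_real LR) / poly R (of_real LR)"
        using PR(1,2)[OF reg] by (simp add: W_det_def den_def D_def x_def y_def z_def field_simps)
      then have det_nz: "W_det EFF E p2 LR \<noteq> 0" using den PR(1)[OF reg] by simp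
      show ?thesis
        unfolding amplitude_conv[OF assms(1) reg det_nz] det PR(2)[OF reg]
        using den PR(1)[OF reg]
        by (simp add: num_def x_def y_def z_def q_def q'_def t_def t'_def field_simps)
    qed
    \<comment> \<open>The effective inverse propagator is singular at regular zeros of
      \<open>den\<close>, so these join the exceptional set of \<open>rational_value\<close>. They
      are finitely many because \<open>den\<close> is nonzero at \<open>LR'\<close> and hence not
      the zero polynomial.\<close>
    have "finite (of_real -` {w. poly den w = 0} :: real set)"
      using den_LR' by (intro finite_vimageI poly_roots_finite) (auto simp: inj_on_def)
    then have "finite ({LR. \<not> regular E LR} \<union> of_real -` {w. poly den w = 0})"
      using finite_not_regular[OF assms(1)] by simp
    then have "finite {LR. amplitude EFF E f1 f2 p2 LR \<sigma> \<tau>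
        \<noteq> poly num (of_real LR) / poly den (of_real LR)}"
      by (rule rev_finite_subset) (use ampl in auto)
    with den_LR' val show ?thesis unfolding rational_value_def by blast
  qed
  ultimately show ?thesis by blast
qed

end
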